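(* Let $n\ge 1$ be an integer and let $A=L\cup R$ be a $P_n$-set that is also an MSTD set, where $L\subset[1,n]$, $R\subset[n+1,2n]$, and $1,2n\in A$. For an integer $k\ge n$, an arbitrary integer $m\ge 0$, and a set $M\subset[n+k+1,n+k+m]$ such that (i) $M$ has no long run of missing elements, in the sense that for every $\ell\in[n+k+1,n+m+1]$ there is a $j\in[\ell,\ell+k-1]$ with $j\in M$, and (ii) $n+k+1\notin M$, set $$A(M;k)=L\cup O_1\cup M\cup O_2\cup R',$$ where $O_1=[n+1,n+k]$, $O_2=[n+k+m+1,n+2k+m]$ and $R'=R+2k+m=\{x+2k+m: x\in R\}$. Then: 1. For every such $k$, $m$, $M$, the set $A(M;k)$ is an MSTD set, and thus one obtains an infinite family of distinct MSTD sets as $M$ varies (over all admissible choices of $k$, $m$, $M$). 2. There is a constant $C>0$ such that, for all sufficiently large $r$, the proportion of the $2^r$ subsets of $\{1,\dots,r\}$ that are in this family (and thus are MSTD sets) is at least $C/r^4$.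
   Context: For integers $a,b$, $[a,b]=\{x\in\mathbb{Z}: a\le x\le b\}$ (empty if $a>b$). For a finite set of integers $A$, $A+A=\{x+y:x,y\in A\}$ and $A-A=\{x-y:x,y\in A\}$; $|X|$ denotes cardinality. $A$ is an MSTD (more sums than differences) set if $|A+A|>|A-A|$. For a finite nonempty set of integers $A$ with $a=\min A$ and $b=\max A$, $A$ is called a $P_n$-set if $[2a+n,2b-n]\subset A+A$ and $[-(b-a)+n,(b-a)-n]\subset A-A$. The initial set $A$ (and hence $n$) is fixed; the family consists of all sets $A(M;k)$ as $k$, $m$, $M$ range over all admissible choices, and the constant $C$ may depend on the fixed $A$. *)

theory Defs
  imports Complex_Main "HOL-Library.Set_Algebras"
begin

text \<open>The sumset is the pointwise sum \<open>A + A\<close> of \<open>Set_Algebras\<close>. The difference set needs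
  its own name, since \<open>A - A\<close> on sets is the set-theoretic difference.\<close>

definition diffset :: "int set \<Rightarrow> int set \<Rightarrow> int set" where
  "diffset A B = {x - y |x y. x \<in> A \<and> y \<in> B}"

definition mstd :: "int set \<Rightarrow> bool" where
  "mstd A \<longleftrightarrow> finite A \<and> card (A + A) > card (diffset A A)"

definition P_set :: "int \<Rightarrow> int set \<Rightarrow> bool" where
  "P_set n A \<longleftrightarrow> finite A \<and> A \<noteq> {} \<and>
     {2 * Min A + n .. 2 * Max A - n} \<subseteq> A + A \<and>
     {- (Max A - Min A) + n .. (Max A - Min A) - n} \<subseteq> diffset A A"

text \<open>The conditions on \<open>k\<close>, \<open>m\<close> and \<open>M\<close>. If \<open>m < k\<close>, the range of \<open>l\<close> is empty.\<close>

definition admissible :: "int \<Rightarrow> int \<Rightarrow> int \<Rightarrow> int set \<Rightarrow> bool" where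
  "admissible n k m M \<longleftrightarrow> k \<ge> n \<and> m \<ge> 0 \<and> M \<subseteq> {n + k + 1 .. n + k + m} \<and>
     (\<forall>l \<in> {n + k + 1 .. n + m + 1}. \<exists>j \<in> {l .. l + k - 1}. j \<in> M) \<and>
     n + k + 1 \<notin> M"

text \<open>\<open>extend n L R k m M\<close> is the set \<open>A(M;k)\<close> built from \<open>A = L \<union> R\<close>.\<close>

definition extend ::
  "int \<Rightarrow> int set \<Rightarrow> int set \<Rightarrow> int \<Rightarrow> int \<Rightarrow> int set \<Rightarrow> int set" where
  "extend n L R k m M =
     L \<union> {n + 1 .. n + k} \<union> M \<union> {n + k + m + 1 .. n + 2 * k + m} \<union> (\<lambda>x. x + 2 * k + m) ` R"

definition family :: "int \<Rightarrow> int set \<Rightarrow> int set \<Rightarrow> int set set" where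
  "family n L R = {extend n L R k m M |k m M. admissible n k m M}"

end

theory Submission
  imports Defs
begin

text \<open>
  \<^emph>\<open>Why \<open>A(M;k)\<close> is MSTD.\<close> Put \<open>s = 2 * k + m\<close>. The set \<open>B = A(M;k)\<close> is \<open>A\<close> cut in the middle,
  with its right half moved by \<open>s\<close> and something inserted in the gap. Sums up to \<open>n + 1\<close> only
  involve the left half, sums within \<open>n - 1\<close> of the maximal one only the right half, and differences
  of large absolute value only one element of each half; so the fringes of \<open>B + B\<close> and of
  \<open>B - B\<close> are translates of those of \<open>A + A\<close> and \<open>A - A\<close>. Passing from \<open>A\<close> to \<open>B\<close> makes room for
  \<open>2 * s\<close> new sums and \<open>2 * s\<close> new differences in between. As \<open>A\<close> already has all the middle
  differences, \<open>B - B\<close> gains at most \<open>2 * s\<close> elements (\<open>card_diffset_stretch_le\<close>). As \<open>B\<close> has all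
  the middle sums, \<open>B + B\<close> gains at least \<open>2 * s\<close> (\<open>card_sumset_stretch_ge\<close>). The middle sums
  of \<open>B\<close> exist because \<open>M\<close> has no gap of length \<open>k\<close> while \<open>O\<^sub>1\<close> and \<open>O\<^sub>2\<close> are runs of
  length \<open>k\<close>: the translates of such a run by the elements of the middle part overlap without
  leaving holes (\<open>extend_middle_sums\<close>).

  \<^emph>\<open>Why the family is large.\<close> The parameters can be read off from the set (\<open>inj_on_extend\<close>), since
  the first missing element beyond \<open>n\<close> marks the end of \<open>O\<^sub>1\<close>. So it is enough to count triples,
  and for a given \<open>r\<close> a single well-chosen \<open>k\<close> already suffices, with \<open>m\<close> such that the maximum of
  the set is \<open>r\<close>. Of the \<open>m\<close> positions available to \<open>M\<close>, all but the first are free; a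
  random \<open>M\<close> misses a given window of length \<open>k\<close> with probability at most \<open>2 / 2 ^ k\<close>, so by the
  union bound at least half of all choices are admissible as soon as \<open>2 ^ k \<ge> 4 * r\<close>.
  If \<open>2 ^ k \<le> 8 * r\<close> as well, the prescribed \<open>2 * n + 2 * k\<close> positions cost only a factor of order
  \<open>r\<^sup>2\<close>, so the proportion is at least \<open>C / r\<^sup>2\<close>, which is stronger than \<open>C / r ^ 4\<close>.
\<close>

section \<open>Stretching a set in the middle\<close>

text \<open>The sums of \<open>A\<close> split into two fringes and a middle part of at most \<open>2 * n - 1\<close> elements. The
  fringes survive in \<open>B + B\<close>, one of them translated by \<open>2 * s\<close>, and the middle part of \<open>B + B\<close> is
  full.\<close>

lemma card_sumset_stretch_ge:
  fixes n s :: int and A B :: "int set"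
  assumes n: "n \<ge> 1" and s: "s \<ge> 0"
    and A: "A \<subseteq> {1..2 * n}" and fin: "finite B"
    and left: "\<And>x. x \<in> A \<Longrightarrow> x \<le> n \<Longrightarrow> x \<in> B"
    and right: "\<And>x. x \<in> A \<Longrightarrow> n + 1 \<le> x \<Longrightarrow> x + s \<in> B"
    and mid: "{n + 2..3 * n + 2 * s} \<subseteq> B + B"
  shows "card (A + A) + nat (2 * s) \<le> card (B + B)"
proof -
  define Lo where "Lo = (A + A) \<inter> {..n + 1}"
  define Hi where "Hi = (A + A) \<inter> {3 * n + 1..}"
  have finA: "finite A"
    using A finite_subset by blast
  have finLo: "finite Lo" and finHi: "finite Hi"
    unfolding Lo_def Hi_def by (simp_all add: finA finite_set_plus)
  have Lo: "Lo \<subseteq> B + B"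
  proof
    fix t assume "t \<in> Lo"
    then obtain x y where xy: "x \<in> A" "y \<in> A" "t = x + y" "x + y \<le> n + 1"
      unfolding Lo_def by (auto elim!: set_plus_elim)
    then have "x \<in> B" "y \<in> B"
      using A left by force+
    with xy show "t \<in> B + B" by auto
  qed
  have Hi: "(\<lambda>t. t + 2 * s) ` Hi \<subseteq> B + B"
  proof
    fix u assume "u \<in> (\<lambda>t. t + 2 * s) ` Hi"
    then obtain x y where xy: "x \<in> A" "y \<in> A" "u = x + y + 2 * s" "3 * n + 1 \<le> x + y"
      unfolding Hi_def by (auto elim!: set_plus_elim)
    then have "x + s \<in> B" "y + s \<in> B"
      using A right by force+
    then have "(x + s) + (y + s) \<in> B + B" by blast
    with xy show "u \<in> B + B" by (simp add: algebra_simps)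
  qed
  have "A + A \<subseteq> Lo \<union> {n + 2..3 * n} \<union> Hi"
    unfolding Lo_def Hi_def by auto
  then have "card (A + A) \<le> card (Lo \<union> {n + 2..3 * n} \<union> Hi)"
    by (intro card_mono) (simp_all add: finLo finHi)
  also have "\<dots> \<le> card Lo + card {n + 2..3 * n} + card Hi"
    by (meson add_le_mono1 card_Un_le order_trans)
  finally have upper: "card (A + A) \<le> card Lo + nat (2 * n - 1) + card Hi"
    by simp
  have "card (Lo \<union> {n + 2..3 * n + 2 * s} \<union> (\<lambda>t. t + 2 * s) ` Hi)
      = card (Lo \<union> {n + 2..3 * n + 2 * s}) + card ((\<lambda>t. t + 2 * s) ` Hi)"
    using n s finLo finHi by (intro card_Un_disjoint) (auto simp: Lo_def Hi_def)
  also have "card (Lo \<union> {n + 2..3 * n + 2 * s}) = card Lo + card {n + 2..3 * n + 2 * s}"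
    using finLo by (intro card_Un_disjoint) (auto simp: Lo_def)
  also have "card ((\<lambda>t. t + 2 * s) ` Hi) = card Hi"
    by (intro card_image inj_onI) simp
  finally have "card Lo + nat (2 * n - 1 + 2 * s) + card Hi
      = card (Lo \<union> {n + 2..3 * n + 2 * s} \<union> (\<lambda>t. t + 2 * s) ` Hi)"
    by simp
  also have "\<dots> \<le> card (B + B)"
    using Lo Hi mid fin by (intro card_mono) (auto simp: finite_set_plus)
  finally show ?thesis
    using upper n s by linarith
qed

lemma finite_diffset: "finite A \<Longrightarrow> finite B \<Longrightarrow> finite (diffset A B)"
proof -
  assume "finite A" "finite B"
  moreover have "diffset A B = (\<lambda>(x, y). x - y) ` (A \<times> B)"
    by (auto simp: diffset_def)
  ultimately show ?thesis by simp
qed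

text \<open>A difference of \<open>B\<close> of absolute value at least \<open>n + s\<close> is forced to be taken between the two
  ends of \<open>B\<close>, which are the halves of \<open>A\<close>; so it is \<open>s\<close> more in absolute value than a
  difference of \<open>A\<close>. The differences of \<open>B\<close> below that size are at most \<open>2 * (n + s) - 1\<close> in
  number, and \<open>A\<close> has all \<open>2 * n - 1\<close> of the corresponding ones.\<close>

lemma card_diffset_stretch_le:
  fixes n s :: int and A B :: "int set"
  assumes n: "n \<ge> 1" and s: "s \<ge> 0"
    and fin: "finite A" and B: "B \<subseteq> {1..2 * n + s}"
    and left: "\<And>x. x \<in> B \<Longrightarrow> x \<le> n \<Longrightarrow> x \<in> A"
    and right: "\<And>x. x \<in> B \<Longrightarrow> n + s + 1 \<le> x \<Longrightarrow> x - s \<in> A"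
    and mid: "{- (n - 1)..n - 1} \<subseteq> diffset A A"
  shows "card (diffset B B) \<le> card (diffset A A) + nat (2 * s)"
proof -
  define Hi where "Hi = diffset A A \<inter> {n..}"
  define Lo where "Lo = diffset A A \<inter> {..- n}"
  have finD: "finite (diffset A A)"
    by (simp add: fin finite_diffset)
  then have finLo: "finite Lo" and finHi: "finite Hi"
    unfolding Lo_def Hi_def by simp_all
  have shift: "x - y - s \<in> diffset A A" if "x \<in> B" "y \<in> B" "n + s \<le> x - y" for x y
  proof -
    have "y \<in> A" "x - s \<in> A"
      using that B left right by force+
    moreover have "x - y - s = (x - s) - y" by simp
    ultimately show ?thesis unfolding diffset_def by blast
  qed
  have "diffset B B \<subseteq> (\<lambda>d. d - s) ` Lo \<union> {- (n + s - 1)..n + s - 1} \<union> (\<lambda>d. d + s) ` Hi"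
  proof
    fix d assume "d \<in> diffset B B"
    then obtain x y where xy: "x \<in> B" "y \<in> B" "d = x - y"
      unfolding diffset_def by blast
    consider "n + s \<le> d" | "d \<le> - (n + s)" | "d \<in> {- (n + s - 1)..n + s - 1}"
      by fastforce
    then show "d \<in> (\<lambda>d. d - s) ` Lo \<union> {- (n + s - 1)..n + s - 1} \<union> (\<lambda>d. d + s) ` Hi"
    proof cases
      case 1
      then have "d - s \<in> Hi"
        using shift[of x y] xy by (simp add: Hi_def)
      then have "(d - s) + s \<in> (\<lambda>d. d + s) ` Hi" by blast
      then show ?thesis by simp
    next
      case 2
      then have "y - x - s \<in> diffset A A"
        using shift[of y x] xy by simp
      then have "- (y - x - s) \<in> diffset A A"
        unfolding diffset_def by force
      moreover have "- (y - x - s) = d + s"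
        using xy by simp
      ultimately have "d + s \<in> diffset A A"
        by metis
      then have "d + s \<in> Lo"
        using 2 by (simp add: Lo_def)
      then have "(d + s) - s \<in> (\<lambda>d. d - s) ` Lo" by blast
      then show ?thesis by simp
    qed simp
  qed
  then have "card (diffset B B)
      \<le> card ((\<lambda>d. d - s) ` Lo \<union> {- (n + s - 1)..n + s - 1} \<union> (\<lambda>d. d + s) ` Hi)"
    using finLo finHi by (intro card_mono) auto
  also have "\<dots> \<le> card ((\<lambda>d. d - s) ` Lo) + card {- (n + s - 1)..n + s - 1}
      + card ((\<lambda>d. d + s) ` Hi)"
    by (meson add_le_mono1 card_Un_le order_trans)
  also have "\<dots> \<le> card Lo + nat (2 * n - 1 + 2 * s) + card Hi"
    using card_image_le[OF finLo] card_image_le[OF finHi]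
    by (intro add_mono) simp_all
  finally have upper: "card (diffset B B) \<le> card Lo + nat (2 * n - 1 + 2 * s) + card Hi" .
  have "card (Lo \<union> {- (n - 1)..n - 1} \<union> Hi) = card (Lo \<union> {- (n - 1)..n - 1}) + card Hi"
    using n finLo finHi by (intro card_Un_disjoint) (auto simp: Lo_def Hi_def)
  also have "card (Lo \<union> {- (n - 1)..n - 1}) = card Lo + card {- (n - 1)..n - 1}"
    using finLo by (intro card_Un_disjoint) (auto simp: Lo_def)
  finally have "card Lo + nat (2 * n - 1) + card Hi = card (Lo \<union> {- (n - 1)..n - 1} \<union> Hi)"
    by simp
  also have "\<dots> \<le> card (diffset A A)"
    using mid finD by (intro card_mono) (auto simp: Lo_def Hi_def)
  finally show ?thesis
    using upper n s by linarith
qed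

section \<open>The extended sets are MSTD\<close>

lemma extend_subset:
  assumes "L \<subseteq> {1..n}" "R \<subseteq> {n + 1..2 * n}" "n \<ge> 1" "admissible n k m M"
  shows "extend n L R k m M \<subseteq> {1..2 * n + 2 * k + m}"
proof -
  have "k \<ge> n" "m \<ge> 0" "M \<subseteq> {n + k + 1..n + k + m}"
    using assms(4) by (simp_all add: admissible_def)
  then have "L \<subseteq> {1..2 * n + 2 * k + m}" "M \<subseteq> {1..2 * n + 2 * k + m}"
    "{n + 1..n + k} \<subseteq> {1..2 * n + 2 * k + m}"
    "{n + k + m + 1..n + 2 * k + m} \<subseteq> {1..2 * n + 2 * k + m}"
    "(\<lambda>x. x + 2 * k + m) ` R \<subseteq> {1..2 * n + 2 * k + m}"
    using assms(1-3) by fastforce+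
  then show ?thesis
    by (simp add: extend_def)
qed

text \<open>Condition (i) speaks of the windows inside the range of \<open>M\<close>; a window that leaves this range
  meets \<open>O\<^sub>1\<close> in its first element or \<open>O\<^sub>2\<close> in its last one.\<close>

lemma window_meets_extend:
  assumes adm: "admissible n k m M" and n: "n \<ge> 1" and l: "n + 1 \<le> l" "l \<le> n + k + m + 1"
  shows "\<exists>j \<in> extend n L R k m M. l \<le> j \<and> j \<le> l + k - 1"
proof -
  have k: "k \<ge> 1" using adm n by (simp add: admissible_def)
  consider "l \<le> n + k" | "n + m + 2 \<le> l" | "l \<in> {n + k + 1..n + m + 1}"
    by fastforce
  then show ?thesis
  proof cases
    case 1
    then have "l \<in> extend n L R k m M" using l by (simp add: extend_def)
    then show ?thesis using k by force
  next
    case 2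
    then have "l + k - 1 \<in> extend n L R k m M" using l by (simp add: extend_def)
    then show ?thesis using k by (intro bexI[of _ "l + k - 1"]) auto
  next
    case 3
    then obtain j where "j \<in> {l..l + k - 1}" "j \<in> M"
      using adm unfolding admissible_def by blast
    then show ?thesis by (force simp: extend_def)
  qed
qed

text \<open>A number \<open>t\<close> is the sum of an element of a run \<open>{a..a + k - 1}\<close> and one of \<open>B\<close> as soon as \<open>B\<close>
  meets the window \<open>{t - a - k + 1..t - a}\<close>; with \<open>O\<^sub>1\<close> and \<open>O\<^sub>2\<close> as the runs, this gives all sums
  from \<open>2 * n + k + 1\<close> to \<open>2 * n + 3 * k + 2 * m + 1\<close>. Below that range, \<open>1 + O\<^sub>1\<close> and \<open>O\<^sub>1 + O\<^sub>1\<close>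
  take over, and they leave no hole between them because \<open>k \<ge> n\<close>. The end above is symmetric.\<close>

lemma extend_middle_sums:
  assumes adm: "admissible n k m M" and n: "n \<ge> 1" and "1 \<in> L" and "2 * n \<in> R"
  defines "B \<equiv> extend n L R k m M"
  shows "{n + 2..3 * n + 2 * (2 * k + m)} \<subseteq> B + B"
proof
  fix t assume t: "t \<in> {n + 2..3 * n + 2 * (2 * k + m)}"
  have k: "k \<ge> n" and m: "m \<ge> 0"
    using adm by (simp_all add: admissible_def)
  have one: "1 \<in> B" and top: "2 * n + 2 * k + m \<in> B"
    using assms by (auto simp: extend_def)
  have O1: "x \<in> B" if "n + 1 \<le> x" "x \<le> n + k" for x
    using that by (simp add: B_def extend_def)
  have O2: "x \<in> B" if "n + k + m + 1 \<le> x" "x \<le> n + 2 * k + m" for x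
    using that by (simp add: B_def extend_def)
  have sum: "t \<in> B + B" if "x \<in> B" "t - x \<in> B" for x
    using set_plus_intro[OF that] by simp
  have run: "t \<in> B + B"
    if in_B: "\<And>x. a \<le> x \<Longrightarrow> x \<le> a + k - 1 \<Longrightarrow> x \<in> B"
      and range: "n + 1 \<le> t - a - k + 1" "t - a - k + 1 \<le> n + k + m + 1" for a
  proof -
    obtain j where "j \<in> B" "t - a - k + 1 \<le> j" "j \<le> t - a"
      using window_meets_extend[OF adm n range, of L R] unfolding B_def by auto
    then show ?thesis using in_B[of "t - j"] sum[of j] by simp
  qed
  consider "t \<le> n + k + 1" | "n + k + 2 \<le> t" "t \<le> 2 * n + k"
    | "2 * n + k + 1 \<le> t" "t \<le> 2 * n + 2 * k + m + 1"
    | "2 * n + 2 * k + m + 1 \<le> t" "t \<le> 2 * n + 3 * k + 2 * m + 1"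
    | "2 * n + 3 * k + 2 * m + 2 \<le> t" "t \<le> 3 * n + 3 * k + 2 * m"
    | "3 * n + 3 * k + 2 * m + 1 \<le> t"
    by linarith
  then show "t \<in> B + B"
  proof cases
    case 1
    then show ?thesis using t by (intro sum[OF one] O1) auto
  next
    case 2
    then show ?thesis using k by (intro sum[of "n + 1"] O1) auto
  next
    case 3
    then show ?thesis by (intro run[of "n + 1"] O1) auto
  next
    case 4
    then show ?thesis by (intro run[of "n + k + m + 1"] O2) auto
  next
    case 5
    then show ?thesis using k n by (intro sum[of "n + 2 * k + m"] O2) auto
  next
    case 6
    then show ?thesis using t by (intro sum[OF top] O2) auto
  qed
qed

lemma mstd_extend:
  assumes n: "n \<ge> 1" and L: "L \<subseteq> {1..n}" and R: "R \<subseteq> {n + 1..2 * n}"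
    and ends: "1 \<in> L" "2 * n \<in> R"
    and P: "P_set n (L \<union> R)" and mstd: "mstd (L \<union> R)" and adm: "admissible n k m M"
  shows "mstd (extend n L R k m M)"
proof -
  define B where "B = extend n L R k m M"
  define s where "s = 2 * k + m"
  have k: "k \<ge> n" and m: "m \<ge> 0" and M: "M \<subseteq> {n + k + 1..n + k + m}"
    using adm by (simp_all add: admissible_def)
  have s: "s \<ge> 0" using n k m by (simp add: s_def)
  have A: "L \<union> R \<subseteq> {1..2 * n}" using L R n by fastforce
  then have finA: "finite (L \<union> R)" using finite_subset by blast
  have B: "B \<subseteq> {1..2 * n + s}"
    using extend_subset[OF L R n adm] by (simp add: B_def s_def add.assoc)
  then have finB: "finite B" using finite_subset by blast
  have "Min (L \<union> R) = 1" "Max (L \<union> R) = 2 * n"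
    using finA ends A by (intro Min_eqI Max_eqI; force)+
  then have middiff: "{- (n - 1)..n - 1} \<subseteq> diffset (L \<union> R) (L \<union> R)"
    using P by (simp add: P_set_def)
  have "card ((L \<union> R) + (L \<union> R)) + nat (2 * s) \<le> card (B + B)"
  proof (rule card_sumset_stretch_ge[OF n s A finB])
    show "x \<in> B" if "x \<in> L \<union> R" "x \<le> n" for x
      using that R by (auto simp: B_def extend_def)
    show "x + s \<in> B" if "x \<in> L \<union> R" "n + 1 \<le> x" for x
    proof -
      have "x \<in> R" using that L by auto
      moreover have "x + s = x + 2 * k + m" by (simp add: s_def)
      ultimately show ?thesis unfolding B_def extend_def by blast
    qed
    show "{n + 2..3 * n + 2 * s} \<subseteq> B + B"
      unfolding B_def s_def using adm n ends by (rule extend_middle_sums)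
  qed
  moreover have "card (diffset B B) \<le> card (diffset (L \<union> R) (L \<union> R)) + nat (2 * s)"
  proof (rule card_diffset_stretch_le[OF n s finA B _ _ middiff])
    show "x \<in> L \<union> R" if "x \<in> B" "x \<le> n" for x
      using that M R n k m by (fastforce simp: B_def extend_def)
    show "x - s \<in> L \<union> R" if "x \<in> B" "n + s + 1 \<le> x" for x
      using that M L n k m by (fastforce simp: B_def extend_def s_def)
  qed
  ultimately have "card (diffset B B) < card (B + B)"
    using mstd unfolding mstd_def by linarith
  then show ?thesis using finB by (simp add: mstd_def B_def)
qed

section \<open>The parameters are determined by the set\<close>

text \<open>The maximum determines \<open>2 * k + m\<close>. For \<open>m > 0\<close>, the smallest element above \<open>n\<close> that is missing
  is \<open>n + k + 1\<close>, by condition (ii). For \<open>m = 0\<close>, the runs \<open>O\<^sub>1\<close> and \<open>O\<^sub>2\<close> merge and \<open>n + k + 1\<close>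
  is present; but the merged run reaches up to \<open>n + 2 * k\<close>, and a triple \<open>(k', m', M')\<close> with the
  same maximum and \<open>m' > 0\<close> has its missing element \<open>n + k' + 1\<close> within that run.\<close>

lemma inj_on_extend:
  assumes n: "n \<ge> 1" and L: "L \<subseteq> {1..n}" and R: "R \<subseteq> {n + 1..2 * n}" and top: "2 * n \<in> R"
  shows "inj_on (\<lambda>(k, m, M). extend n L R k m M) {(k, m, M). admissible n k m M}"
proof -
  have max_le: "2 * k + m \<le> 2 * k' + m'"
    if "admissible n k' m' M'" "extend n L R k m M = extend n L R k' m' M'"
    for k m M k' m' M'
  proof -
    have "2 * n + 2 * k + m \<in> extend n L R k m M"
      using top by (auto simp: extend_def)
    then show ?thesis
      using extend_subset[OF L R n that(1)] that(2) by force
  qed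
  have hole: "n + k + 1 \<notin> extend n L R k m M" if "admissible n k m M" "m > 0" for k m M
    using that L R n unfolding extend_def admissible_def by fastforce
  have k_le: "k' \<le> k"
    if "admissible n k m M" "admissible n k' m' M'" "m > 0" "2 * k + m = 2 * k' + m'"
      "extend n L R k m M = extend n L R k' m' M'"
    for k m M k' m' M'
  proof (rule ccontr)
    assume "\<not> k' \<le> k"
    then have "n + k + 1 \<in> extend n L R k' m' M'"
      using that(1) n by (simp add: extend_def admissible_def)
    then show False using hole that by metis
  qed
  have zero: False
    if "admissible n k m M" "admissible n k' m' M'" "m > 0" "m' = 0" "2 * k + m = 2 * k' + m'"
      "extend n L R k m M = extend n L R k' m' M'"
    for k m M k' m' M'
  proof -
    have "n + k + 1 \<in> extend n L R k' m' M'"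
      using that(1-5) n by (auto simp: extend_def admissible_def)
    then show False using hole that by metis
  qed
  have middle: "M = extend n L R k m M \<inter> {n + k + 1..n + k + m}" if "admissible n k m M" for k m M
    using that L R n unfolding extend_def admissible_def by fastforce
  have "k = k' \<and> m = m' \<and> M = M'"
    if adm: "admissible n k m M" "admissible n k' m' M'"
      and eq: "extend n L R k m M = extend n L R k' m' M'"
    for k m M k' m' M'
  proof -
    have max: "2 * k + m = 2 * k' + m'"
      using max_le[OF adm(2) eq] max_le[OF adm(1) eq[symmetric]] by simp
    have "m \<ge> 0" "m' \<ge> 0"
      using adm by (simp_all add: admissible_def)
    then consider "m = 0" "m' = 0" | "m > 0" "m' > 0"
      using zero[OF adm _ _ max eq] zero[OF adm(2,1) _ _ max[symmetric] eq[symmetric]]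
      by fastforce
    then have "k = k'"
    proof cases
      case 1
      then show ?thesis using max by simp
    next
      case 2
      then show ?thesis
        using k_le[OF adm _ max eq] k_le[OF adm(2,1) _ max[symmetric] eq[symmetric]] by simp
    qed
    then show ?thesis
      using max middle[OF adm(1)] middle[OF adm(2)] eq by auto
  qed
  then show ?thesis unfolding inj_on_def by fast
qed

lemma infinite_family:
  assumes n: "n \<ge> 1" and L: "L \<subseteq> {1..n}" and R: "R \<subseteq> {n + 1..2 * n}" and top: "2 * n \<in> R"
  shows "infinite (family n L R)"
proof
  let ?T = "{(k, m, M). admissible n k m M}"
  assume "finite (family n L R)"
  moreover have "family n L R = (\<lambda>(k, m, M). extend n L R k m M) ` ?T"
    by (force simp: family_def)
  ultimately have "finite ?T"
    using finite_imageD inj_on_extend[OF assms] by metis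
  moreover have "(\<lambda>k. (k, 0, {})) ` {n..} \<subseteq> ?T"
    using n by (auto simp: admissible_def)
  ultimately have "finite ((\<lambda>k::int. (k, 0::int, {}::int set)) ` {n..})"
    by (rule rev_finite_subset)
  then have "finite {n..}"
    by (rule finite_imageD) (auto intro: inj_onI)
  then show False by (simp add: infinite_Ici)
qed

section \<open>Counting the family\<close>

text \<open>This is the union bound: the subsets of \<open>I\<close> that avoid \<open>W l\<close> are the subsets of \<open>I - W l\<close>.\<close>

lemma card_hitting_sets_ge:
  assumes I: "finite I" and J: "finite J" and d: "\<And>l. l \<in> J \<Longrightarrow> d \<le> card (I \<inter> W l)"
  shows "2 ^ card I \<le> card {M. M \<subseteq> I \<and> (\<forall>l \<in> J. M \<inter> W l \<noteq> {})} + card J * 2 ^ (card I - d)"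
proof -
  let ?G = "{M. M \<subseteq> I \<and> (\<forall>l \<in> J. M \<inter> W l \<noteq> {})}"
  have "Pow I \<subseteq> ?G \<union> (\<Union>l \<in> J. Pow (I - W l))" by auto
  then have "card (Pow I) \<le> card (?G \<union> (\<Union>l \<in> J. Pow (I - W l)))"
    using I J by (intro card_mono) auto
  also have "\<dots> \<le> card ?G + card (\<Union>l \<in> J. Pow (I - W l))"
    by (rule card_Un_le)
  also have "card (\<Union>l \<in> J. Pow (I - W l)) \<le> (\<Sum>l \<in> J. card (Pow (I - W l)))"
    using J by (rule card_UN_le)
  also have "\<dots> \<le> (\<Sum>l \<in> J. 2 ^ (card I - d))"
  proof (rule sum_mono)
    fix l assume "l \<in> J"
    then have "card (I - W l) \<le> card I - d"
      using d[of l] I by (simp add: card_Diff_subset_Int diff_le_mono2)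
    then show "card (Pow (I - W l)) \<le> 2 ^ (card I - d)"
      using I by (simp add: card_Pow)
  qed
  finally show ?thesis using I by (simp add: card_Pow)
qed

lemma finite_admissible: "finite {M. admissible n k m M}"
  by (rule finite_subset[of _ "Pow {n + k + 1..n + k + m}"]) (auto simp: admissible_def)

text \<open>As \<open>n + k + 1\<close> must be left out, \<open>M\<close> is a subset of a set of \<open>m - 1\<close> elements, and a window may
  lose one element to this restriction. There are at most \<open>m\<close> windows, so, by
  the choice of \<open>k\<close>, at most \<open>m * 2 ^ (m - k) \<le> 2 ^ (m - 2)\<close> of the \<open>2 ^ (m - 1)\<close> subsets are excluded.\<close>

lemma card_admissible_ge:
  fixes n k m :: nat
  assumes n: "n \<ge> 1" and k: "k \<ge> n" and m: "m \<ge> 2" and long: "4 * m \<le> 2 ^ k"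
  shows "2 ^ (m - 2) \<le> card {M. admissible (int n) (int k) (int m) M}"
proof (cases "k \<le> m")
  case True
  define I where "I = {int (n + k + 2)..int (n + k + m)}"
  define J where "J = {int (n + k + 1)..int (n + m + 1)}"
  let ?W = "\<lambda>l::int. {l..l + int k - 1}"
  let ?G = "{M. M \<subseteq> I \<and> (\<forall>l \<in> J. M \<inter> ?W l \<noteq> {})}"
  have cardI: "card I = m - 1" by (simp add: I_def)
  have cardJ: "card J \<le> m" using n k by (simp add: J_def)
  have "2 ^ card I \<le> card ?G + card J * 2 ^ (card I - (k - 1))"
  proof (rule card_hitting_sets_ge)
    fix l assume "l \<in> J"
    then have "{l + 1..l + int k - 1} \<subseteq> I \<inter> ?W l"
      by (auto simp: I_def J_def)
    then have "card {l + 1..l + int k - 1} \<le> card (I \<inter> ?W l)"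
      by (intro card_mono) (simp_all add: I_def)
    then show "k - 1 \<le> card (I \<inter> ?W l)" by simp
  qed (simp_all add: I_def J_def)
  moreover have "card J * 2 ^ (card I - (k - 1)) \<le> (2::nat) ^ (m - 2)"
  proof -
    have "4 * (card J * 2 ^ (card I - (k - 1))) \<le> 4 * m * 2 ^ (m - k)"
      using cardJ cardI n k by simp
    also have "\<dots> \<le> 2 ^ k * 2 ^ (m - k)"
      using long by (rule mult_right_mono) simp
    also have "\<dots> = (2::nat) ^ m"
      using True by (simp flip: power_add)
    also have "\<dots> = 2 ^ (2 + (m - 2))"
      by (simp only: le_add_diff_inverse[OF m])
    also have "\<dots> = 4 * 2 ^ (m - 2)"
      by (simp only: power_add) simp
    finally show ?thesis by simp
  qed
  moreover have "(2::nat) ^ card I = 2 ^ (m - 2) + 2 ^ (m - 2)"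
  proof -
    have "card I = Suc (m - 2)" using m cardI by simp
    then show ?thesis by simp
  qed
  ultimately have "2 ^ (m - 2) \<le> card ?G" by linarith
  also have "\<dots> \<le> card {M. admissible (int n) (int k) (int m) M}"
  proof (rule card_mono[OF finite_admissible])
    show "?G \<subseteq> {M. admissible (int n) (int k) (int m) M}"
    proof
      fix M assume "M \<in> ?G"
      then have M: "M \<subseteq> I" and hit: "\<And>l. l \<in> J \<Longrightarrow> M \<inter> ?W l \<noteq> {}" by auto
      have "\<exists>j \<in> ?W l. j \<in> M" if "l \<in> {int n + int k + 1..int n + int m + 1}" for l
        using hit[of l] that by (auto simp: J_def)
      then show "M \<in> {M. admissible (int n) (int k) (int m) M}"
        using M k by (force simp: admissible_def I_def)
    qed
  qed
  finally show ?thesis .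
next
  case False
  \<comment> \<open>No window fits into the range of \<open>M\<close>, so every subset of the free positions is admissible.\<close>
  define I where "I = {int (n + k + 2)..int (n + k + m)}"
  have "2 ^ (m - 2) \<le> (2::nat) ^ (m - 1)" by (intro power_increasing) auto
  also have "\<dots> = card (Pow I)" by (simp add: I_def card_Pow)
  also have "\<dots> \<le> card {M. admissible (int n) (int k) (int m) M}"
  proof (rule card_mono[OF finite_admissible])
    show "Pow I \<subseteq> {M. admissible (int n) (int k) (int m) M}"
      using False k by (force simp: admissible_def I_def)
  qed
  finally show ?thesis .
qed

lemma card_family_ge:
  fixes n k m r :: nat
  assumes n: "n \<ge> 1" and L: "L \<subseteq> {1..int n}" and R: "R \<subseteq> {int n + 1..2 * int n}"
    and top: "2 * int n \<in> R"
    and k: "k \<ge> n" and m: "m \<ge> 2" and long: "4 * m \<le> 2 ^ k" and r: "r = 2 * n + 2 * k + m"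
  shows "2 ^ (m - 2) \<le> card {S. S \<subseteq> {1..int r} \<and> S \<in> family (int n) L R}"
proof -
  have n': "int n \<ge> 1" using n by simp
  let ?adm = "{M. admissible (int n) (int k) (int m) M}"
  let ?f = "extend (int n) L R (int k) (int m)"
  have "2 ^ (m - 2) \<le> card ?adm"
    using n k m long by (rule card_admissible_ge)
  also have "\<dots> = card (?f ` ?adm)"
  proof (rule card_image[symmetric], rule inj_onI)
    fix M M' assume "M \<in> ?adm" "M' \<in> ?adm" "?f M = ?f M'"
    then show "M = M'"
      using inj_onD[OF inj_on_extend[OF n' L R top],
          of "(int k, int m, M)" "(int k, int m, M')"] by simp
  qed
  also have "\<dots> \<le> card {S. S \<subseteq> {1..int r} \<and> S \<in> family (int n) L R}"
  proof (rule card_mono)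
    show "?f ` ?adm \<subseteq> {S. S \<subseteq> {1..int r} \<and> S \<in> family (int n) L R}"
      using extend_subset[OF L R n'] r by (fastforce simp: family_def)
  qed simp
  finally show ?thesis .
qed

text \<open>The window length is \<open>k = j + 3\<close>, where \<open>2 ^ j \<le> r < 2 ^ (j + 1)\<close>: then \<open>4 * r < 2 ^ k \<le> 8 * r\<close>,
  so that \<open>k\<close> is long enough for the union bound and yet \<open>2 ^ (2 * k) \<le> 64 * r\<^sup>2\<close>. The bound
  on \<open>r\<close> makes \<open>j \<ge> 2 * n + 8\<close>, so that \<open>2 * n + 2 * k + 2 \<le> 3 * j\<close>, and this is less than \<open>2 ^ j\<close>:
  there is room for \<open>m \<ge> 2\<close>.\<close>

lemma family_proportion_ge:
  fixes n :: nat
  assumes n: "n \<ge> 1" and L: "L \<subseteq> {1..int n}" and R: "R \<subseteq> {int n + 1..2 * int n}"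
    and top: "2 * int n \<in> R" and r: "r \<ge> 2 ^ (2 * n + 8)"
  shows "1 / (256 * 4 ^ n) / real r ^ 2
    \<le> real (card {S. S \<subseteq> {1..int r} \<and> S \<in> family (int n) L R}) / 2 ^ r"
proof -
  have "r \<ge> 1" using r order_trans[OF one_le_power[of "2::nat"]] by simp
  then obtain j where j: "2 ^ j \<le> r" "r < 2 ^ (j + 1)"
    using ex_power_ivl1[of 2 r] by auto
  have "(2::nat) ^ (2 * n + 8) < 2 ^ (j + 1)" using r j by linarith
  then have "2 * n + 8 < j + 1" by (rule power_less_imp_less_exp[rotated]) simp
  then have jn: "2 * n + 8 \<le> j" by simp
  have "3 * i < 2 ^ i" if "4 \<le> i" for i :: nat
    using that by (induction i rule: dec_induct) auto
  from this[of j] have j3: "3 * j < r" using jn j by linarith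
  define k where "k = j + 3"
  define m where "m = r - 2 * n - 2 * k"
  have m: "m \<ge> 2" and rm: "r = 2 * n + 2 * k + m"
    using j3 jn by (simp_all add: m_def k_def)
  have "4 * m \<le> 2 ^ k"
    using j rm by (simp add: k_def power_add)
  then have card: "2 ^ (m - 2) \<le> card {S. S \<subseteq> {1..int r} \<and> S \<in> family (int n) L R}"
    using card_family_ge[OF n L R top _ m _ rm] jn by (simp add: k_def)
  have "real (2 ^ j) \<le> real r"
    using j(1) by (rule of_nat_mono)
  then have "(2::real) ^ k \<le> 8 * real r"
    by (simp add: k_def power_add)
  then have "((2::real) ^ k) ^ 2 \<le> (8 * real r) ^ 2"
    by (rule power_mono) simp
  then have k2: "(2::real) ^ (2 * k) \<le> 64 * real r ^ 2"
    by (simp add: power_mult_distrib power_mult[symmetric] mult.commute)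
  have "r = 2 * n + 2 * k + 2 + (m - 2)" using rm m by simp
  then have "(2::real) ^ r = 2 ^ (2 * n + 2 * k + 2 + (m - 2))" by simp
  also have "\<dots> = 4 * 4 ^ n * 2 ^ (2 * k) * 2 ^ (m - 2)"
    by (simp add: power_add power_mult)
  finally have split: "(2::real) ^ r = 4 * 4 ^ n * 2 ^ (2 * k) * 2 ^ (m - 2)" .
  have "1 / (256 * 4 ^ n) / real r ^ 2 = 1 / (4 * 4 ^ n * (64 * real r ^ 2))"
    by simp
  also have "\<dots> \<le> 1 / (4 * 4 ^ n * 2 ^ (2 * k))"
    using k2 by (intro divide_left_mono mult_left_mono mult_pos_pos) (use \<open>r \<ge> 1\<close> in auto)
  also have "\<dots> = 2 ^ (m - 2) / 2 ^ r"
    unfolding split by simp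
  also have "\<dots> \<le> real (card {S. S \<subseteq> {1..int r} \<and> S \<in> family (int n) L R}) / 2 ^ r"
    using of_nat_mono[OF card, where 'a = real] by (intro divide_right_mono) simp_all
  finally show ?thesis .
qed

theorem theorem1p1:
  fixes n :: int and A L R :: "int set"
  assumes "n \<ge> 1"
    and "A = L \<union> R"
    and "L \<subseteq> {1 .. n}"
    and "R \<subseteq> {n + 1 .. 2 * n}"
    and "1 \<in> A" and "2 * n \<in> A"
    and "P_set n A"
    and "mstd A"
  shows "((\<forall>k m M. admissible n k m M \<longrightarrow> mstd (extend n L R k m M)) \<and>
          infinite (family n L R) \<and>
          inj_on (\<lambda>(k, m, M). extend n L R k m M) {(k, m, M). admissible n k m M}) \<and>
         (\<exists>C::real. C > 0 \<and>
            (\<forall>\<^sub>F r in sequentially.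
               real (card {S. S \<subseteq> {1 .. int r} \<and> S \<in> family n L R}) / 2 ^ r
                 \<ge> C / real r ^ 4))"
proof -
  note n = assms(1) and L = assms(3) and R = assms(4)
  have one: "1 \<in> L" using assms by auto
  have top: "2 * n \<in> R" using assms by auto
  define N where "N = nat n"
  have N: "n = int N" "N \<ge> 1" using n by (simp_all add: N_def)
  have "\<forall>\<^sub>F r in sequentially. 1 / (256 * 4 ^ N) / real r ^ 4
      \<le> real (card {S. S \<subseteq> {1..int r} \<and> S \<in> family n L R}) / 2 ^ r"
    using eventually_ge_at_top[of "2 ^ (2 * N + 8)"]
  proof eventually_elim
    case (elim r)
    then have "r \<ge> 1" using order_trans[OF one_le_power[of "2::nat"]] by simp
    then have "1 / (256 * 4 ^ N) / real r ^ 4 \<le> 1 / (256 * 4 ^ N) / real r ^ 2"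
      by (intro divide_left_mono power_increasing) auto
    also have "\<dots> \<le> real (card {S. S \<subseteq> {1..int r} \<and> S \<in> family n L R}) / 2 ^ r"
      using family_proportion_ge[of N L R r] N L R top elim by simp
    finally show ?case .
  qed
  moreover have "1 / (256 * 4 ^ N) > (0::real)" by simp
  ultimately have "\<exists>C::real. C > 0 \<and> (\<forall>\<^sub>F r in sequentially.
      real (card {S. S \<subseteq> {1 .. int r} \<and> S \<in> family n L R}) / 2 ^ r \<ge> C / real r ^ 4)"
    by blast
  then show ?thesis
    using mstd_extend[OF n L R one top] infinite_family[OF n L R top] inj_on_extend[OF n L R top]
      assms(2,7,8) by blast
qed

end
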